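(* Let $k,\ell,n$ be odd positive integers, let $r=n+k+\ell$, and let $m>n+k+\ell$ be an even integer. Let $\mathcal{S}$ be an $\mathrm{MS}(2,3,\mathbb{Z}_2^n\times\mathbb{Z}_{k+1}\times\mathbb{Z}_{\ell+1})$ and let $\{\mathcal{T}_1,\ldots,\mathcal{T}_r,\mathcal{R}\}$ be an $(m,r)$-pairs-triples design, with one-factors $\mathcal{T}_1,\ldots,\mathcal{T}_r$ and set of triples $\mathcal{R}$ on the point set $\mathbb{Z}_m$. Index the coordinates of $\mathbb{Z}_2^n\times\mathbb{Z}_{k+1}\times\mathbb{Z}_{\ell+1}\times\mathbb{Z}_2^m$ by $0,1,\ldots,n+m+1$: coordinates $0,\ldots,n-1$ are those of $\mathbb{Z}_2^n$, coordinate $n$ is that of $\mathbb{Z}_{k+1}$, coordinate $n+1$ is that of $\mathbb{Z}_{\ell+1}$, and coordinate $n+2+\alpha$, for $\alpha\in\mathbb{Z}_m=\{0,\ldots,m-1\}$, is the $\alpha$-th coordinate of $\mathbb{Z}_2^m$. Let $\mathcal{S}'$ be the set consisting of the following words: (1) all codewords of $\mathcal{S}$, extended by zeros in the $m$ new coordinates; (2) $\{(i,1),(n+2+\alpha,1),(n+2+\beta,1)\}$ for $i\in\mathbb{Z}_n$ and $\{\alpha,\beta\}\in\mathcal{T}_{i+1}$; (3) $\{(n,j),(n+2+\alpha,1),(n+2+\beta,1)\}$ for $j\in\mathbb{Z}_{k+1}\setminus\{0\}$ and $\{\alpha,\beta\}\in\mathcal{T}_{n+j}$; (4) $\{(n+1,j),(n+2+\alpha,1),(n+2+\beta,1)\}$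 for $j\in\mathbb{Z}_{\ell+1}\setminus\{0\}$ and $\{\alpha,\beta\}\in\mathcal{T}_{n+k+j}$; (5) $\{(n+2+\alpha,1),(n+2+\beta,1),(n+2+\gamma,1)\}$ for $\{\alpha,\beta,\gamma\}\in\mathcal{R}$. Then $\mathcal{S}'$ is an $\mathrm{MS}(2,3,\mathbb{Z}_2^n\times\mathbb{Z}_{k+1}\times\mathbb{Z}_{\ell+1}\times\mathbb{Z}_2^m)$.
   Context: $\mathbb{Z}_q=\{0,1,\ldots,q-1\}$. For a mixed alphabet $Q=\mathbb{Z}_{q_1}\times\cdots\times\mathbb{Z}_{q_N}$ with all $q_i\ge 2$, the weight of a word in $Q$ is its number of nonzero coordinates, and $d(x,y)$ is the Hamming distance (the number of coordinates in which $x$ and $y$ differ). A mixed Steiner triple system $\mathrm{MS}(2,3,Q)$ is a set $\mathcal{C}\subseteq Q$ of words (codewords) of weight $3$ such that (i) for each word $x\in Q$ of weight $2$ there is exactly one $c\in\mathcal{C}$ that covers $x$, i.e. $d(x,c)=1$; and (ii) the minimum Hamming distance of $\mathcal{C}$ is $3$, meaning $d(c,c')\ge 3$ for all distinct $c,c'\in\mathcal{C}$. Notation: $\{(i_1,\alpha_1),(i_2,\alpha_2),(i_3,\alpha_3)\}$ (distinct positions $i_1,i_2,i_3$, nonzero values $\alpha_1,\alpha_2,\alpha_3$) denotes the weight-3 word with value $\alpha_s$ in position $i_s$ for $s=1,2,3$ and zero elsewhere. A one-factor of $K_m$ on the point set $\mathbb{Z}_m$ ($m$ even) is a partition of $\mathbb{Z}_m$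 into $m/2$ disjoint pairs. An $(m,r)$-pairs-triples design, where $m$ is even and $r$ is odd, is $\{\mathcal{T}_1,\ldots,\mathcal{T}_r,\mathcal{R}\}$, where $\mathcal{T}_1,\ldots,\mathcal{T}_r$ are pairwise disjoint one-factors of $K_m$ on the point set $\mathbb{Z}_m$ and $\mathcal{R}$ is a set of triples (3-subsets) of $\mathbb{Z}_m$, such that each pair (2-subset) of $\mathbb{Z}_m$ is contained in exactly one of the following: one of the $\mathcal{T}_i$'s (as a member), or a unique triple of $\mathcal{R}$ (but not both). *)

theory Defs
  imports "HOL-Library.Disjoint_Sets"
begin

text \<open>A mixed alphabet is represented by the list of its moduli, and its words are lists of
  naturals of the same length, with coordinates numbered from 0.\<close>

definition words :: "nat list \<Rightarrow> nat list set" where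
  "words qs = {x. length x = length qs \<and> (\<forall>i<length qs. x ! i < qs ! i)}"

definition weight :: "nat list \<Rightarrow> nat" where
  "weight x = card {i. i < length x \<and> x ! i \<noteq> 0}"

text \<open>Only meaningful for words of the same length.\<close>

definition hdist :: "nat list \<Rightarrow> nat list \<Rightarrow> nat" where
  "hdist x y = card {i. i < length x \<and> x ! i \<noteq> y ! i}"

definition covers :: "nat list \<Rightarrow> nat list \<Rightarrow> bool" where
  "covers c x \<longleftrightarrow> hdist x c = 1"

definition mixed_steiner_triple_system :: "nat list \<Rightarrow> nat list set \<Rightarrow> bool" where
  "mixed_steiner_triple_system qs C \<longleftrightarrow>
     (\<forall>q\<in>set qs. 2 \<le> q) \<and>
     C \<subseteq> words qs \<and>
     (\<forall>c\<in>C. weight c = 3) \<and>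
     (\<forall>x\<in>words qs. weight x = 2 \<longrightarrow> (\<exists>!c. c \<in> C \<and> covers c x)) \<and>
     (\<forall>c\<in>C. \<forall>c'\<in>C. c \<noteq> c' \<longrightarrow> 3 \<le> hdist c c')"

text \<open>The word of length \<open>N\<close> with three prescribed entries and zeros elsewhere; the three
  positions are meant to be distinct and smaller than \<open>N\<close>.\<close>

definition word3 :: "nat \<Rightarrow> nat \<times> nat \<Rightarrow> nat \<times> nat \<Rightarrow> nat \<times> nat \<Rightarrow> nat list" where
  "word3 N p1 p2 p3 =
     (replicate N 0)[fst p1 := snd p1, fst p2 := snd p2, fst p3 := snd p3]"

text \<open>A partition of the points into pairs; that there are \<open>m div 2\<close> of them is automatic.\<close>

definition one_factor :: "nat \<Rightarrow> nat set set \<Rightarrow> bool" where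
  "one_factor m T \<longleftrightarrow> partition_on {..<m} T \<and> (\<forall>P\<in>T. card P = 2)"

text \<open>The one-factors are \<open>T 1, \<dots>, T r\<close>; other values of \<open>T\<close> are irrelevant. They are disjoint
  as sets of pairs. A pair is either in exactly one of them and in no triple, or in none of
  them and in exactly one triple.\<close>

definition pairs_triples_design ::
    "nat \<Rightarrow> nat \<Rightarrow> (nat \<Rightarrow> nat set set) \<Rightarrow> nat set set \<Rightarrow> bool" where
  "pairs_triples_design m r T R \<longleftrightarrow>
     even m \<and> odd r \<and>
     (\<forall>i\<in>{1..r}. one_factor m (T i)) \<and>
     disjoint_family_on T {1..r} \<and>
     (\<forall>B\<in>R. B \<subseteq> {..<m} \<and> card B = 3) \<and>
     (\<forall>P. P \<subseteq> {..<m} \<and> card P = 2 \<longrightarrow>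
        ((\<exists>!i. i \<in> {1..r} \<and> P \<in> T i) \<and> \<not> (\<exists>B\<in>R. P \<subseteq> B)) \<or>
        (\<not> (\<exists>i\<in>{1..r}. P \<in> T i) \<and> (\<exists>!B. B \<in> R \<and> P \<subseteq> B)))"

definition extended_system ::
    "nat \<Rightarrow> nat \<Rightarrow> nat \<Rightarrow> nat \<Rightarrow> nat list set \<Rightarrow> (nat \<Rightarrow> nat set set) \<Rightarrow> nat set set
      \<Rightarrow> nat list set" where
  "extended_system n k l m S T R =
     (let w = word3 (n + 2 + m) in
       {c @ replicate m 0 | c. c \<in> S} \<union>
       {w (i, 1) (n + 2 + a, 1) (n + 2 + b, 1) | i a b.
          i \<in> {0..<n} \<and> {a, b} \<in> T (i + 1)} \<union>
       {w (n, j) (n + 2 + a, 1) (n + 2 + b, 1) | j a b.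
          j \<in> {1..k} \<and> {a, b} \<in> T (n + j)} \<union>
       {w (n + 1, j) (n + 2 + a, 1) (n + 2 + b, 1) | j a b.
          j \<in> {1..l} \<and> {a, b} \<in> T (n + k + j)} \<union>
       {w (n + 2 + a, 1) (n + 2 + b, 1) (n + 2 + c, 1) | a b c.
          {a, b, c} \<in> R})"

end

theory Submission
  imports Defs
begin

text \<open>A triple system is determined by the condition that any two prescribed nonzero entries occur
  together in exactly one codeword. This forces distinct codewords to share at most one entry, so
  two of them can be at distance less than 3 only if they have equal supports and share exactly one
  entry. In the extended system a support meeting the new coordinates determines its codeword,
  because the one-factors are disjoint. The nonzero entries of the first \<open>n + 2\<close>
  coordinates are numbered bijectively by the one-factors; hence two entries are completed by \<open>S\<close>
  if both are old, by the partner in the one-factor if one is old, and by a one-factor or a triple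
  of \<open>R\<close> if both are new.\<close>

section \<open>Triple systems in terms of entries\<close>

definition nonzeros :: "nat list \<Rightarrow> nat set" where
  "nonzeros x = {i. i < length x \<and> x ! i \<noteq> 0}"

lemma finite_nonzeros [simp]: "finite (nonzeros x)"
  by (simp add: nonzeros_def)

lemma weight_eq_card_nonzeros: "weight x = card (nonzeros x)"
  by (simp add: weight_def nonzeros_def)

lemma words_length: "x \<in> words qs \<Longrightarrow> length x = length qs"
  by (simp add: words_def)

lemma words_nth_less: "x \<in> words qs \<Longrightarrow> i < length qs \<Longrightarrow> x ! i < qs ! i"
  by (simp add: words_def)

text \<open>A difference inside the support of \<open>x\<close> would force the support of
  \<open>c\<close> into that of \<open>x\<close>, which is too small. Conversely, agreement on the
  support of \<open>x\<close> leaves only the one extra position of \<open>c\<close> as a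
  difference.\<close>

lemma covers_iff_agree:
  assumes len: "length x = length c" and "weight x = 2" "weight c = 3"
  shows "covers c x \<longleftrightarrow> (\<forall>i\<in>nonzeros x. c ! i = x ! i)"
proof
  assume "covers c x"
  then obtain d where d: "{i. i < length x \<and> x ! i \<noteq> c ! i} = {d}"
    unfolding covers_def hdist_def by (auto simp: card_1_singleton_iff)
  then have agree: "x ! i = c ! i" if "i < length x" "i \<noteq> d" for i
    using that by blast
  have "d \<notin> nonzeros x"
  proof
    assume "d \<in> nonzeros x"
    then have "nonzeros c \<subseteq> nonzeros x"
      using agree len unfolding nonzeros_def by force
    then have "card (nonzeros c) \<le> card (nonzeros x)"
      by (simp add: card_mono)
    then show False
      using assms by (simp add: weight_eq_card_nonzeros)
  qed
  then show "\<forall>i\<in>nonzeros x. c ! i = x ! i"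
    using agree by (metis (mono_tags, lifting) mem_Collect_eq nonzeros_def)
next
  assume agree: "\<forall>i\<in>nonzeros x. c ! i = x ! i"
  have sub: "nonzeros x \<subseteq> nonzeros c"
    using agree len by (auto simp: nonzeros_def)
  have "{i. i < length x \<and> x ! i \<noteq> c ! i} = nonzeros c - nonzeros x"
    using agree len by (auto simp: nonzeros_def)
  then show "covers c x"
    using sub assms
    by (simp add: covers_def hdist_def card_Diff_subset weight_eq_card_nonzeros)
qed

text \<open>Condition (i) without words of weight 2: such a word amounts to two nonzero entries.
  Ordering the positions lists each pair of entries once.\<close>

definition pair_property :: "nat list \<Rightarrow> nat list set \<Rightarrow> bool" where
  "pair_property qs C \<longleftrightarrow>
     (\<forall>i j a b. i < j \<longrightarrow> j < length qs \<longrightarrow> 0 < a \<longrightarrow> a < qs ! i \<longrightarrow> 0 < b \<longrightarrow> b < qs ! j \<longrightarrow>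
        (\<exists>!c. c \<in> C \<and> c ! i = a \<and> c ! j = b))"

text \<open>Words of weight 2 correspond to pairs of nonzero entries at distinct positions, and
  \<open>covers_iff_agree\<close> turns covering into agreement at both.\<close>

lemma pair_property_iff_covered:
  assumes qs: "\<forall>q\<in>set qs. 2 \<le> q" and C: "C \<subseteq> words qs" and wt: "\<forall>c\<in>C. weight c = 3"
  shows "pair_property qs C \<longleftrightarrow>
    (\<forall>x\<in>words qs. weight x = 2 \<longrightarrow> (\<exists>!c. c \<in> C \<and> covers c x))"
proof
  assume pp: "pair_property qs C"
  show "\<forall>x\<in>words qs. weight x = 2 \<longrightarrow> (\<exists>!c. c \<in> C \<and> covers c x)"
  proof (intro ballI impI)
    fix x
    assume x: "x \<in> words qs" and w: "weight x = 2"
    then obtain i' j' where ij': "nonzeros x = {i', j'}" "i' \<noteq> j'"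
      by (auto simp: weight_eq_card_nonzeros card_2_iff)
    obtain i j where ij: "nonzeros x = {i, j}" "i < j"
    proof (cases "i' < j'")
      case False
      then have "j' < i'" "nonzeros x = {j', i'}"
        using ij' by auto
      then show ?thesis
        using that by blast
    qed (use ij' that in blast)
    have "i \<in> nonzeros x" "j \<in> nonzeros x"
      using ij by auto
    then have bds: "j < length qs" "0 < x ! i" "x ! i < qs ! i" "0 < x ! j" "x ! j < qs ! j"
      using x by (auto simp: nonzeros_def words_def)
    have "covers c x \<longleftrightarrow> c ! i = x ! i \<and> c ! j = x ! j" if "c \<in> C" for c
      using that C wt w x ij covers_iff_agree[of x c] by (auto simp: words_def)
    moreover have "\<exists>!c. c \<in> C \<and> c ! i = x ! i \<and> c ! j = x ! j"
      using pp bds ij(2) unfolding pair_property_def by blast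
    ultimately show "\<exists>!c. c \<in> C \<and> covers c x"
      by metis
  qed
next
  assume cov: "\<forall>x\<in>words qs. weight x = 2 \<longrightarrow> (\<exists>!c. c \<in> C \<and> covers c x)"
  show "pair_property qs C"
    unfolding pair_property_def
  proof (intro allI impI)
    fix i j a b
    assume h: "i < j" "j < length qs" "0 < a" "a < qs ! i" "0 < b" "b < qs ! j"
    define x where "x = (replicate (length qs) 0)[i := a, j := b]"
    have nth: "x ! p = (if p = j then b else if p = i then a else 0)" if "p < length qs" for p
      using that h by (auto simp: x_def nth_list_update)
    have len: "length x = length qs"
      by (simp add: x_def)
    have nz: "nonzeros x = {i, j}"
      using h nth by (auto simp: nonzeros_def len split: if_splits)
    have w: "weight x = 2"
      using h by (simp add: weight_eq_card_nonzeros nz)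
    have xw: "x \<in> words qs"
    proof -
      have "x ! p < qs ! p" if "p < length qs" for p
      proof -
        have "2 \<le> qs ! p"
          using qs that by simp
        then show ?thesis
          using h nth[OF that] by auto
      qed
      then show ?thesis
        by (simp add: words_def len)
    qed
    have "x ! i = a" "x ! j = b"
      using h nth by simp_all
    moreover have "covers c x \<longleftrightarrow> c ! i = x ! i \<and> c ! j = x ! j" if "c \<in> C" for c
      using that C wt w xw nz covers_iff_agree[of x c] by (auto simp: words_def)
    ultimately have "covers c x \<longleftrightarrow> c ! i = a \<and> c ! j = b" if "c \<in> C" for c
      using that by simp
    then show "\<exists>!c. c \<in> C \<and> c ! i = a \<and> c ! j = b"
      using cov xw w by metis
  qed
qed

text \<open>The uniqueness half of \<open>pair_property\<close>, freed from the order of the two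
  positions.\<close>

lemma pair_property_shared_entries:
  assumes pp: "pair_property qs C" and C: "C \<subseteq> words qs" and c: "c \<in> C" "c' \<in> C"
    and "i \<in> nonzeros c" "j \<in> nonzeros c" "i \<noteq> j" "c ! i = c' ! i" "c ! j = c' ! j"
  shows "c = c'"
proof -
  have *: "c = c'" if "p < q" "p \<in> nonzeros c" "q \<in> nonzeros c" "c ! p = c' ! p" "c ! q = c' ! q"
    for p q
  proof -
    have q: "q < length qs" and pos: "0 < c ! p" "0 < c ! q"
      using that(2,3) words_length[OF subsetD[OF C c(1)]] by (auto simp: nonzeros_def)
    moreover have "c ! p < qs ! p" "c ! q < qs ! q"
      using words_nth_less[OF subsetD[OF C c(1)]] that(1) q by auto
    ultimately have "\<exists>!d. d \<in> C \<and> d ! p = c ! p \<and> d ! q = c ! q"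
      using pp that(1) unfolding pair_property_def by blast
    then show ?thesis
      using c that by metis
  qed
  consider "i < j" | "j < i"
    using assms(7) by linarith
  then show ?thesis
    by cases (use *[of i j] *[of j i] assms(5-) in blast)+
qed

text \<open>If \<open>c\<close> and \<open>c'\<close> share no entry on the support of
  \<open>c\<close>, all three positions there differ. Otherwise they share just one, so two
  positions differ, and a third comes from the support of \<open>c'\<close>, which
  \<open>eq_supp\<close> makes different from that of \<open>c\<close>.\<close>

lemma mixed_steiner_triple_systemI:
  assumes qs: "\<forall>q\<in>set qs. 2 \<le> q" and C: "C \<subseteq> words qs" and wt: "\<forall>c\<in>C. weight c = 3"
    and pp: "pair_property qs C"
    and eq_supp: "\<And>c c' e. \<lbrakk>c \<in> C; c' \<in> C; nonzeros c = nonzeros c'; e \<in> nonzeros c; c ! e = c' ! e\<rbrakk>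
      \<Longrightarrow> c = c'"
  shows "mixed_steiner_triple_system qs C"
proof -
  have "3 \<le> hdist c c'" if c: "c \<in> C" "c' \<in> C" and ne: "c \<noteq> c'" for c c'
  proof -
    let ?D = "{i. i < length c \<and> c ! i \<noteq> c' ! i}"
    have len: "length c' = length c"
      using C c words_length by (metis subsetD)
    have card: "card (nonzeros c) = 3" "card (nonzeros c') = 3"
      using wt c by (auto simp: weight_eq_card_nonzeros)
    have fin: "finite ?D"
      by simp
    show ?thesis
    proof (cases "\<exists>e\<in>nonzeros c. c ! e = c' ! e")
      case False
      then have "nonzeros c \<subseteq> ?D"
        by (auto simp: nonzeros_def)
      then show ?thesis
        using card_mono[OF fin, of "nonzeros c"] card by (simp add: hdist_def)
    next
      case True
      then obtain e where e: "e \<in> nonzeros c" "c ! e = c' ! e"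
        by blast
      then have "nonzeros c \<noteq> nonzeros c'"
        using eq_supp c ne by blast
      \<comment> \<open>Both supports have three elements, so being different, neither contains the
        other.\<close>
      then obtain b where b: "b \<in> nonzeros c'" "b \<notin> nonzeros c"
        using card by (metis card_subset_eq finite_nonzeros subsetI)
      have "c ! p \<noteq> c' ! p" if "p \<in> nonzeros c - {e}" for p
        using pair_property_shared_entries[OF pp C c, of e p] e that ne by auto
      then have "insert b (nonzeros c - {e}) \<subseteq> ?D"
        using b len by (auto simp: nonzeros_def)
      moreover have "card (insert b (nonzeros c - {e})) = 3"
        using b e card by simp
      ultimately show ?thesis
        using card_mono[OF fin, of "insert b (nonzeros c - {e})"] unfolding hdist_def by linarith
    qed
  qed
  then show ?thesis
    using qs C wt pp pair_property_iff_covered[OF qs C wt]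
    by (simp add: mixed_steiner_triple_system_def)
qed

lemma mixed_steiner_triple_systemD:
  assumes "mixed_steiner_triple_system qs C"
  shows "\<forall>q\<in>set qs. 2 \<le> q" "C \<subseteq> words qs" "\<forall>c\<in>C. weight c = 3" "pair_property qs C"
proof -
  show *: "\<forall>q\<in>set qs. 2 \<le> q" "C \<subseteq> words qs" "\<forall>c\<in>C. weight c = 3"
    using assms unfolding mixed_steiner_triple_system_def by blast+
  show "pair_property qs C"
    using assms pair_property_iff_covered[OF *] unfolding mixed_steiner_triple_system_def by blast
qed

text \<open>The condition \<open>eq_supp\<close> above is also necessary: all differences lie in the
  common support of three positions, so agreement at \<open>e\<close> leaves distance at most
  2.\<close>

lemma mixed_steiner_triple_system_eq_supp:
  assumes M: "mixed_steiner_triple_system qs C" and c: "c \<in> C" "c' \<in> C"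
    and supp: "nonzeros c = nonzeros c'" and e: "e \<in> nonzeros c" "c ! e = c' ! e"
  shows "c = c'"
proof (rule ccontr)
  assume "c \<noteq> c'"
  then have "3 \<le> hdist c c'"
    using M c by (auto simp: mixed_steiner_triple_system_def)
  moreover have len: "length c = length c'"
    using mixed_steiner_triple_systemD(2)[OF M] c words_length by (metis subsetD)
  have "{i. i < length c \<and> c ! i \<noteq> c' ! i} \<subseteq> (nonzeros c \<union> nonzeros c') - {e}"
    using len e(2) unfolding nonzeros_def by auto
  then have "{i. i < length c \<and> c ! i \<noteq> c' ! i} \<subseteq> nonzeros c - {e}"
    unfolding supp by simp
  then have "hdist c c' \<le> card (nonzeros c - {e})"
    unfolding hdist_def by (simp add: card_mono)
  moreover have "card (nonzeros c) = 3"
    using mixed_steiner_triple_systemD(3)[OF M] c by (simp add: weight_eq_card_nonzeros)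
  ultimately show False
    using e by simp
qed

section \<open>Pairs-triples designs\<close>

lemma one_factor_mem:
  assumes "one_factor m F" "P \<in> F"
  shows "P \<subseteq> {..<m}" "card P = 2"
  using assms by (auto simp: one_factor_def partition_on_def)

text \<open>This completes an old and a new entry: the pair at \<open>a\<close> supplies the third
  position.\<close>

lemma one_factor_ex1:
  assumes "one_factor m F" "a < m"
  shows "\<exists>!P. P \<in> F \<and> a \<in> P"
proof (rule ex_ex1I)
  have part: "partition_on {..<m} F"
    using assms(1) by (simp add: one_factor_def)
  show "\<exists>P. P \<in> F \<and> a \<in> P"
  proof -
    have "a \<in> \<Union>F"
      unfolding partition_onD1[OF part, symmetric] using assms(2) by simp
    then show ?thesis
      by blast
  qed
  show "P = P'" if "P \<in> F \<and> a \<in> P" "P' \<in> F \<and> a \<in> P'" for P P'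
    using disjointD[OF partition_onD2[OF part], of P P'] that by blast
qed

lemma pairs_triples_design_pair:
  assumes "pairs_triples_design m r T R" "a < m" "b < m" "a \<noteq> b"
  shows "((\<exists>!i. i \<in> {1..r} \<and> {a, b} \<in> T i) \<and> \<not> (\<exists>B\<in>R. {a, b} \<subseteq> B)) \<or>
    (\<not> (\<exists>i\<in>{1..r}. {a, b} \<in> T i) \<and> (\<exists>!B. B \<in> R \<and> {a, b} \<subseteq> B))"
proof -
  have "\<forall>P. P \<subseteq> {..<m} \<and> card P = 2 \<longrightarrow>
        ((\<exists>!i. i \<in> {1..r} \<and> P \<in> T i) \<and> \<not> (\<exists>B\<in>R. P \<subseteq> B)) \<or>
        (\<not> (\<exists>i\<in>{1..r}. P \<in> T i) \<and> (\<exists>!B. B \<in> R \<and> P \<subseteq> B))"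
    using assms(1) unfolding pairs_triples_design_def by (elim conjE)
  then show ?thesis
    by (rule allE[of _ "{a, b}"]) (use assms(2-4) in simp)
qed

section \<open>The extended system\<close>

text \<open>A common form of the words (2) to (5): at most one old entry \<open>v\<close> at
  \<open>i\<close>, and ones at the new positions given by a set \<open>B\<close> shifted by
  \<open>N\<close>. A set carries no order of its elements, and \<open>v = 0\<close> leaves only new
  positions.\<close>

definition block_word :: "nat \<Rightarrow> nat \<Rightarrow> nat \<Rightarrow> nat \<Rightarrow> nat set \<Rightarrow> nat list" where
  "block_word N m i v B =
     map (\<lambda>p. if p = i then v else if N \<le> p \<and> p - N \<in> B then 1 else 0) [0..<N + m]"

lemma length_block_word [simp]: "length (block_word N m i v B) = N + m"
  by (simp add: block_word_def)

lemma nth_block_word: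
  "p < N + m \<Longrightarrow>
    block_word N m i v B ! p = (if p = i then v else if N \<le> p \<and> p - N \<in> B then 1 else 0)"
  by (simp add: block_word_def)

lemma nonzeros_block_word:
  assumes "B \<subseteq> {..<m}" "i < N"
  shows "nonzeros (block_word N m i v B) = (if v = 0 then {} else {i}) \<union> (+) N ` B"
proof -
  have "p \<in> (+) N ` B \<longleftrightarrow> N \<le> p \<and> p - N \<in> B" for p
    by (auto simp: image_iff intro: bexI[of _ "p - N"])
  then show ?thesis
    using assms by (auto simp: nonzeros_def nth_block_word split: if_splits)
qed

lemma weight_block_word:
  assumes "B \<subseteq> {..<m}" "i < N"
  shows "weight (block_word N m i v B) = (if v = 0 then 0 else 1) + card B"
proof -
  have "finite B"
    using assms finite_subset by blast
  moreover have "card ((+) N ` B) = card B"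
    by (simp add: card_image)
  moreover have "i \<notin> (+) N ` B"
    using assms by auto
  ultimately show ?thesis
    by (simp add: weight_eq_card_nonzeros nonzeros_block_word[OF assms])
qed

lemma length_word3 [simp]: "length (word3 N p1 p2 p3) = N"
  by (simp add: word3_def)

lemma word3_eq_block_word:
  assumes "i < N" "a < m" "b < m"
  shows "word3 (N + m) (i, v) (N + a, 1) (N + b, 1) = block_word N m i v {a, b}"
  using assms by (intro nth_equalityI) (auto simp: nth_block_word word3_def nth_list_update)

text \<open>A word of kind (5) has no old entry: position 0, which is old since
  \<open>0 < N\<close>, receives the dummy value 0.\<close>

lemma word3_eq_block_word_triple:
  assumes "0 < N" "a < m" "b < m" "c < m"
  shows "word3 (N + m) (N + a, 1) (N + b, 1) (N + c, 1) = block_word N m 0 0 {a, b, c}"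
  using assms by (intro nth_equalityI) (auto simp: nth_block_word word3_def nth_list_update)

text \<open>The number of the one-factor attached to the nonzero entry \<open>v\<close> in the old coordinate \<open>i\<close>.\<close>

definition factor_index :: "nat \<Rightarrow> nat \<Rightarrow> nat \<Rightarrow> nat \<Rightarrow> nat" where
  "factor_index n k i v = (if i < n then i + 1 else if i = n then n + v else n + k + v)"

section \<open>Numbering of the old entries by the one-factors\<close>

locale steiner_extension =
  fixes k l n m r :: nat and S :: "nat list set" and T :: "nat \<Rightarrow> nat set set" and R :: "nat set set"
    and qs :: "nat list" and N :: nat
  assumes r: "r = n + k + l"
    and qs: "qs = replicate n 2 @ [k + 1, l + 1]" and N: "N = n + 2"
    and steiner: "mixed_steiner_triple_system qs S"
    and design: "pairs_triples_design m r T R"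
begin

abbreviation "idx \<equiv> factor_index n k"

lemma length_qs [simp]: "length qs = N"
  by (simp add: qs N)

lemma N_pos: "0 < N"
  by (simp add: N)

lemma nth_qs: "i < N \<Longrightarrow> qs ! i = (if i < n then 2 else if i = n then k + 1 else l + 1)"
  by (auto simp: qs N nth_append nth_Cons')

lemma idx_range: "i < N \<Longrightarrow> 0 < v \<Longrightarrow> v < qs ! i \<Longrightarrow> idx i v \<in> {1..r}"
  by (auto simp: factor_index_def nth_qs r split: if_splits)

text \<open>The values fill three consecutive intervals of lengths \<open>n\<close>,
  \<open>k\<close> and \<open>l\<close>, one for each range of coordinates. In the first, the
  modulus 2 forces the entry to be 1, so the coordinate alone fixes the number.\<close>

lemma idx_inj:
  assumes "i < N" "0 < v" "v < qs ! i" "i' < N" "0 < v'" "v' < qs ! i'" "idx i v = idx i' v'"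
  shows "i = i' \<and> v = v'"
  using assms by (auto simp: factor_index_def nth_qs N split: if_splits)

lemma idx_surj:
  assumes "t \<in> {1..r}"
  obtains i v where "i < N" "0 < v" "v < qs ! i" "idx i v = t"
proof -
  consider "t \<le> n" | "n < t" "t \<le> n + k" | "n + k < t"
    by linarith
  then show ?thesis
  proof cases
    case 1
    \<comment> \<open>Coordinates start at 0 and one-factors at 1; the entry chosen here is
      1.\<close>
    then have "t - 1 < n" "t - 1 + 1 = t"
      using assms by auto
    then show ?thesis
      using that[of "t - 1" 1] by (simp add: factor_index_def nth_qs N)
  next
    case 2
    then show ?thesis
      using assms that[of n "t - n"] by (auto simp: factor_index_def nth_qs N)
  next
    case 3
    then show ?thesis
      using assms that[of "n + 1" "t - n - k"] by (auto simp: factor_index_def nth_qs N r)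
  qed
qed

section \<open>The design and the set of codewords\<close>

lemma factor: "t \<in> {1..r} \<Longrightarrow> one_factor m (T t)"
  using design by (auto simp: pairs_triples_design_def)

lemma factor_unique: "t \<in> {1..r} \<Longrightarrow> t' \<in> {1..r} \<Longrightarrow> P \<in> T t \<Longrightarrow> P \<in> T t' \<Longrightarrow> t = t'"
  using design unfolding pairs_triples_design_def disjoint_family_on_def by blast

lemma triple: "B \<in> R \<Longrightarrow> B \<subseteq> {..<m}" "B \<in> R \<Longrightarrow> card B = 3"
  using design by (auto simp: pairs_triples_design_def)

text \<open>The words (1) to (5), with (2) to (4) merged into one rule by the numbering
  \<open>idx\<close>, so that later case distinctions have three kinds instead of five.\<close>

inductive_set ext :: "nat list set" where
  old: "s \<in> S \<Longrightarrow> s @ replicate m 0 \<in> ext"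
| mixed: "i < N \<Longrightarrow> 0 < v \<Longrightarrow> v < qs ! i \<Longrightarrow> P \<in> T (idx i v) \<Longrightarrow> block_word N m i v P \<in> ext"
| new: "B \<in> R \<Longrightarrow> block_word N m 0 0 B \<in> ext"

lemma mixed_word:
  assumes "i < N" "0 < v" "v < qs ! i" "{a, b} \<in> T (idx i v)"
  shows "word3 (N + m) (i, v) (N + a, 1) (N + b, 1) \<in> ext"
proof -
  have "a < m" "b < m"
    using one_factor_mem(1)[OF factor[OF idx_range[OF assms(1-3)]] assms(4)] by auto
  then show ?thesis
    using assms ext.mixed word3_eq_block_word by simp
qed

lemma new_word:
  assumes "{a, b, c} \<in> R"
  shows "word3 (N + m) (N + a, 1) (N + b, 1) (N + c, 1) \<in> ext"
proof -
  have "a < m" "b < m" "c < m"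
    using triple(1)[OF assms] by auto
  then show ?thesis
    using ext.new[OF assms] word3_eq_block_word_triple[OF N_pos] by metis
qed

lemma extended_system_eq_ext: "extended_system n k l m S T R = ext"
proof (rule Set.set_eqI, rule iffI)
  fix c
  assume "c \<in> extended_system n k l m S T R"
  then consider (1) s where "s \<in> S" "c = s @ replicate m 0"
    | (2) i a b where "i \<in> {0..<n}" "{a, b} \<in> T (i + 1)"
      "c = word3 (N + m) (i, 1) (N + a, 1) (N + b, 1)"
    | (3) j a b where "j \<in> {1..k}" "{a, b} \<in> T (n + j)"
      "c = word3 (N + m) (n, j) (N + a, 1) (N + b, 1)"
    | (4) j a b where "j \<in> {1..l}" "{a, b} \<in> T (n + k + j)"
      "c = word3 (N + m) (n + 1, j) (N + a, 1) (N + b, 1)"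
    | (5) a b d where "{a, b, d} \<in> R" "c = word3 (N + m) (N + a, 1) (N + b, 1) (N + d, 1)"
    unfolding extended_system_def Let_def N by (elim UnE CollectE exE conjE) blast+
  then show "c \<in> ext"
  proof cases
    case 1
    then show ?thesis
      by (simp add: ext.old)
  next
    case 2
    then show ?thesis
      using mixed_word[of i 1 a b] by (simp add: factor_index_def nth_qs N)
  next
    case 3
    then show ?thesis
      using mixed_word[of n j a b] by (simp add: factor_index_def nth_qs N)
  next
    case 4
    then show ?thesis
      using mixed_word[of "n + 1" j a b] by (simp add: factor_index_def nth_qs N)
  next
    case 5
    then show ?thesis
      using new_word by metis
  qed
next
  fix c
  assume "c \<in> ext"
  then show "c \<in> extended_system n k l m S T R"
  proof cases
    case (old s)
    then show ?thesis
      by (auto simp: extended_system_def Let_def)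
  next
    case (mixed i v P)
    have "P \<subseteq> {..<m}" "card P = 2"
      using one_factor_mem factor idx_range mixed by blast+
    then obtain a b where ab: "P = {a, b}" "a < m" "b < m"
      by (auto simp: card_2_iff)
    have c: "c = word3 (n + 2 + m) (i, v) (n + 2 + a, 1) (n + 2 + b, 1)"
      using word3_eq_block_word[OF mixed(2) ab(2,3), of v] mixed(1) ab(1) unfolding N by simp
    \<comment> \<open>The range of \<open>i\<close> selects clause (2), (3) or (4); for
      \<open>i < n\<close> the modulus 2 forces \<open>v = 1\<close>.\<close>
    consider "i < n" "v = 1" | "i = n" "v \<in> {1..k}" | "i = n + 1" "v \<in> {1..l}"
      using mixed by (auto simp: nth_qs N split: if_splits)
    then show ?thesis
    proof cases
      case 1
      then have "{a, b} \<in> T (i + 1)"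
        using mixed ab by (simp add: factor_index_def)
      then show ?thesis
        using 1 c unfolding extended_system_def Let_def by force
    next
      case 2
      then have "{a, b} \<in> T (n + v)"
        using mixed ab by (simp add: factor_index_def)
      then show ?thesis
        using 2 c unfolding extended_system_def Let_def by blast
    next
      case 3
      then have "{a, b} \<in> T (n + k + v)"
        using mixed ab by (simp add: factor_index_def)
      then show ?thesis
        using 3 c unfolding extended_system_def Let_def by blast
    qed
  next
    case (new B)
    then obtain a b d where B: "B = {a, b, d}" "a < m" "b < m" "d < m"
      using triple[of B] by (auto simp: card_3_iff)
    then have "c = word3 (n + 2 + m) (n + 2 + a, 1) (n + 2 + b, 1) (n + 2 + d, 1)"
      using word3_eq_block_word_triple[OF N_pos B(2-4)] new(1) B(1) unfolding N by simp
    then show ?thesis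
      using new B unfolding extended_system_def Let_def by blast
  qed
qed

section \<open>Entries, supports and weights of the codewords\<close>

lemma nth_old:
  assumes "s \<in> S" "p < N + m"
  shows "(s @ replicate m 0) ! p = (if p < N then s ! p else 0)"
  using assms mixed_steiner_triple_systemD(2)[OF steiner]
  by (auto simp: words_def nth_append)

lemma nonzeros_old:
  assumes "s \<in> S"
  shows "nonzeros (s @ replicate m 0) = nonzeros s" "nonzeros s \<subseteq> {..<N}" "nonzeros s \<noteq> {}"
proof -
  have len: "length s = N"
    using assms mixed_steiner_triple_systemD(2)[OF steiner] by (auto simp: words_def)
  then show "nonzeros (s @ replicate m 0) = nonzeros s" "nonzeros s \<subseteq> {..<N}"
    using nth_old[OF assms] by (auto simp: nonzeros_def split: if_splits)
  show "nonzeros s \<noteq> {}"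
    using assms mixed_steiner_triple_systemD(3)[OF steiner]
    by (auto simp: weight_eq_card_nonzeros)
qed

lemma mixed_pair:
  assumes "i < N" "0 < v" "v < qs ! i" "P \<in> T (idx i v)"
  shows "P \<subseteq> {..<m}" "card P = 2"
  using one_factor_mem[OF factor[OF idx_range[OF assms(1-3)]] assms(4)] by auto

lemma nonzeros_mixed:
  assumes "i < N" "0 < v" "v < qs ! i" "P \<in> T (idx i v)"
  shows "nonzeros (block_word N m i v P) = insert i ((+) N ` P)"
  using nonzeros_block_word[OF mixed_pair(1)[OF assms] assms(1), of v] assms by simp

lemma nonzeros_new:
  assumes "B \<in> R"
  shows "nonzeros (block_word N m 0 0 B) = (+) N ` B"
  using nonzeros_block_word[OF triple(1)[OF assms], of 0 N 0] N_pos by simp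

lemma ext_words: "ext \<subseteq> words (qs @ replicate m 2)"
proof
  fix c
  assume "c \<in> ext"
  then show "c \<in> words (qs @ replicate m 2)"
  proof cases
    case (old s)
    then have "s \<in> words qs"
      using mixed_steiner_triple_systemD(2)[OF steiner] by blast
    then show ?thesis
      using old by (auto simp: words_def nth_append)
  next
    case (mixed i v P)
    \<comment> \<open>The entry \<open>v\<close> is bounded by its own modulus; every other entry is
      0 or 1, which moduli of at least 2 admit.\<close>
    moreover have "\<forall>p<N. 2 \<le> qs ! p"
      using mixed_steiner_triple_systemD(1)[OF steiner] by (metis length_qs nth_mem)
    ultimately show ?thesis
      by (fastforce simp: words_def nth_append nth_block_word)
  next
    case (new B)
    moreover have "\<forall>p<N. 2 \<le> qs ! p"
      using mixed_steiner_triple_systemD(1)[OF steiner] by (metis length_qs nth_mem)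
    ultimately show ?thesis
      by (fastforce simp: words_def nth_append nth_block_word)
  qed
qed

lemma ext_weight:
  assumes "c \<in> ext"
  shows "weight c = 3"
  using assms
proof cases
  case (old s)
  then show ?thesis
    using mixed_steiner_triple_systemD(3)[OF steiner] nonzeros_old(1)
    by (simp add: weight_eq_card_nonzeros)
next
  case (mixed i v P)
  then show ?thesis
    using mixed_pair[of i v P] by (simp add: weight_block_word)
next
  case (new B)
  then show ?thesis
    using triple[of B] N_pos by (simp add: weight_block_word)
qed

section \<open>Completing two entries, and codewords with equal support\<close>

lemma ext_old_unique:
  assumes "c \<in> ext" "i < j" "j < N" "c ! i \<noteq> 0" "c ! j \<noteq> 0"
  obtains s where "s \<in> S" "c = s @ replicate m 0"
  using assms(1)
proof cases
  case (old s)
  then show ?thesis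
    using that by blast
next
  \<comment> \<open>Such a word has a single old entry, so it cannot be nonzero at both
    \<open>i\<close> and \<open>j\<close>.\<close>
  case (mixed i' v P)
  then show ?thesis
    using assms by (auto simp: nth_block_word split: if_splits)
next
  case (new B)
  then show ?thesis
    using assms by (auto simp: nth_block_word split: if_splits)
qed

text \<open>Old words vanish on the new coordinates and words of kind (5) on the old ones. In the
  remaining kind the only old entry is the prescribed one, so it fixes the one-factor.\<close>

lemma ext_mixed_unique:
  assumes "c \<in> ext" "i < N" "N \<le> j" "j < N + m" "c ! i \<noteq> 0" "c ! j \<noteq> 0"
  obtains P where "0 < c ! i" "c ! i < qs ! i" "P \<in> T (idx i (c ! i))" "j - N \<in> P"
    "c = block_word N m i (c ! i) P"
  using assms(1)
proof cases
  case (old s)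
  then show ?thesis
    using assms by (simp add: nth_old)
next
  case (mixed i' v P)
  then have "i' = i" "c ! i = v" "j - N \<in> P"
    using assms by (auto simp: nth_block_word split: if_splits)
  then show ?thesis
    using that[of P] mixed by simp
next
  case (new B)
  then show ?thesis
    using assms by (auto simp: nth_block_word split: if_splits)
qed

lemma ext_pair_property: "pair_property (qs @ replicate m 2) ext"
  unfolding pair_property_def
proof (intro allI impI)
  fix i j a b
  assume ij: "i < j" and jl: "j < length (qs @ replicate m 2)"
    and a: "0 < a" "a < (qs @ replicate m 2) ! i" and b: "0 < b" "b < (qs @ replicate m 2) ! j"
  from jl have j: "j < N + m"
    by simp
  consider "j < N" | "i < N" "N \<le> j" | "N \<le> i"
    by linarith
  then show "\<exists>!c. c \<in> ext \<and> c ! i = a \<and> c ! j = b"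
  proof cases
    case 1
    then have "\<exists>!s. s \<in> S \<and> s ! i = a \<and> s ! j = b"
      using mixed_steiner_triple_systemD(4)[OF steiner] ij a b
      unfolding pair_property_def by (simp add: nth_append)
    then obtain s where s: "s \<in> S" "s ! i = a" "s ! j = b"
      and uniq: "\<And>s'. s' \<in> S \<Longrightarrow> s' ! i = a \<Longrightarrow> s' ! j = b \<Longrightarrow> s' = s"
      by blast
    show ?thesis
    proof (rule ex1I[of _ "s @ replicate m 0"])
      show "s @ replicate m 0 \<in> ext \<and> (s @ replicate m 0) ! i = a \<and> (s @ replicate m 0) ! j = b"
        using s 1 ij by (simp add: ext.old nth_old)
      fix c
      assume c: "c \<in> ext \<and> c ! i = a \<and> c ! j = b"
      then obtain s' where s': "s' \<in> S" "c = s' @ replicate m 0"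
        using ext_old_unique[of c i j] ij 1 a b by auto
      then show "c = s @ replicate m 0"
        using uniq[of s'] c 1 ij nth_old by simp
    qed
  next
    case 2
    then have a': "a < qs ! i" and b': "b = 1"
      using a b j by (auto simp: nth_append)
    \<comment> \<open>The third position is the partner of \<open>j - N\<close> in the one-factor
      numbered by the old entry.\<close>
    have "\<exists>!P. P \<in> T (idx i a) \<and> j - N \<in> P"
      using one_factor_ex1[OF factor[OF idx_range]] 2 a(1) a' j by simp
    then obtain P where P: "P \<in> T (idx i a)" "j - N \<in> P"
      and uniq: "\<And>P'. P' \<in> T (idx i a) \<Longrightarrow> j - N \<in> P' \<Longrightarrow> P' = P"
      by blast
    show ?thesis
    proof (rule ex1I[of _ "block_word N m i a P"])
      show "block_word N m i a P \<in> ext \<and> block_word N m i a P ! i = a \<and> block_word N m i a P ! j = b"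
        using P 2 a a' b' j by (simp add: ext.mixed nth_block_word)
      fix c
      assume c: "c \<in> ext \<and> c ! i = a \<and> c ! j = b"
      then show "c = block_word N m i a P"
        using ext_mixed_unique[of c i j] 2 j a b uniq by (metis not_gr_zero)
    qed
  next
    case 3
    then have a': "a = 1" and b': "b = 1"
      using a b ij j by (auto simp: nth_append)
    let ?P = "{i - N, j - N}"
    have bds: "i - N < m" "j - N < m" "i - N \<noteq> j - N"
      using 3 ij j by auto
    have block: "block_word N m h v B ! i = 1 \<and> block_word N m h v B ! j = 1 \<longleftrightarrow> ?P \<subseteq> B"
      if "h < N" for h v B
      using that 3 ij j by (auto simp: nth_block_word)
    have pair: "P = ?P" if "?P \<subseteq> P" "card P = 2" for P
    proof -
      \<comment> \<open>An infinite set has cardinality 0, so cardinality 2 gives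
        finiteness.\<close>
      have "finite P"
        using that(2) card.infinite by fastforce
      moreover have "card ?P = card P"
        using that(2) bds(3) by simp
      ultimately show ?thesis
        using card_subset_eq that(1) by metis
    qed
    \<comment> \<open>Only two kinds of codewords reach two new positions: those from a pair of a
      one-factor, which is then \<open>?P\<close> itself, and those from a triple containing
      \<open>?P\<close>. The design decides which kind occurs.\<close>
    have cases: "(\<exists>h v. h < N \<and> 0 < v \<and> v < qs ! h \<and> ?P \<in> T (idx h v) \<and> c = block_word N m h v ?P)
        \<or> (\<exists>B\<in>R. ?P \<subseteq> B \<and> c = block_word N m 0 0 B)" if "c \<in> ext" "c ! i = a" "c ! j = b" for c
      using that(1)
    proof cases
      case (old s)
      then show ?thesis
        using that a 3 ij j by (simp add: nth_old)
    next
      case (mixed h v P)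
      then have "?P \<subseteq> P"
        using block[of h v P] that a' b' by simp
      then have "P = ?P"
        using pair mixed mixed_pair(2) by blast
      then show ?thesis
        using mixed by blast
    next
      case (new B)
      then show ?thesis
        using block[OF N_pos, of 0 B] that a' b' by blast
    qed
    from pairs_triples_design_pair[OF design bds] show ?thesis
    proof (elim disjE conjE)
      assume t: "\<exists>!t. t \<in> {1..r} \<and> ?P \<in> T t" and no: "\<not> (\<exists>B\<in>R. ?P \<subseteq> B)"
      then obtain t where "t \<in> {1..r}" "?P \<in> T t"
        by blast
      \<comment> \<open>Surjectivity of the numbering supplies the old entry to be joined to
        \<open>?P\<close>.\<close>
      then obtain h v where hv: "h < N" "0 < v" "v < qs ! h" "?P \<in> T (idx h v)"
        using idx_surj by metis
      show ?thesis
      proof (rule ex1I[of _ "block_word N m h v ?P"])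
        show "block_word N m h v ?P \<in> ext \<and> block_word N m h v ?P ! i = a \<and> block_word N m h v ?P ! j = b"
          using ext.mixed[OF hv] block[OF hv(1)] a' b' by blast
        fix c
        assume "c \<in> ext \<and> c ! i = a \<and> c ! j = b"
        then obtain h' v' where "h' < N" "0 < v'" "v' < qs ! h'" "?P \<in> T (idx h' v')"
          "c = block_word N m h' v' ?P"
          using cases no by blast
        \<comment> \<open>By disjointness \<open>?P\<close> determines the number of its one-factor,
          and injectivity of \<open>idx\<close> then determines the old entry.\<close>
        then show "c = block_word N m h v ?P"
          using factor_unique[of "idx h v" "idx h' v'" ?P] hv idx_range idx_inj by metis
      qed
    next
      assume no: "\<not> (\<exists>t\<in>{1..r}. ?P \<in> T t)" and ex1: "\<exists>!B. B \<in> R \<and> ?P \<subseteq> B"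
      from ex1 obtain B where B: "B \<in> R" "?P \<subseteq> B" and uniq: "\<And>B'. B' \<in> R \<Longrightarrow> ?P \<subseteq> B' \<Longrightarrow> B' = B"
        by (elim ex1E conjE) metis
      show ?thesis
      proof (rule ex1I[of _ "block_word N m 0 0 B"])
        show "block_word N m 0 0 B \<in> ext \<and> block_word N m 0 0 B ! i = a \<and> block_word N m 0 0 B ! j = b"
          using ext.new[OF B(1)] block[OF N_pos, of 0 B] B(2) a' b' by blast
        fix c
        assume "c \<in> ext \<and> c ! i = a \<and> c ! j = b"
        \<comment> \<open>\<open>?P\<close> lies in no one-factor with a number in
          \<open>{1..r}\<close>, and \<open>idx_range\<close> keeps all numbers there, so only a
          triple remains.\<close>
        then obtain B' where "B' \<in> R" "?P \<subseteq> B'" "c = block_word N m 0 0 B'"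
          using cases[of c] no idx_range by metis
        then show "c = block_word N m 0 0 B"
          using uniq by metis
      qed
    qed
  qed
qed

text \<open>The support reveals the kind of a codeword. An old support hands the question, with the
  shared entry \<open>e\<close>, over to \<open>S\<close>. Otherwise the support gives the block and
  the old position, if there is one, and the value there is recovered from the one-factor containing
  the block.\<close>

lemma ext_eq_supp:
  assumes c: "c \<in> ext" "c' \<in> ext" and supp: "nonzeros c = nonzeros c'"
    and e: "e \<in> nonzeros c" "c ! e = c' ! e"
  shows "c = c'"
proof -
  have inj: "B = B'" if "(+) N ` B = (+) N ` B'" for B B'
    using that by (simp add: inj_image_eq_iff)
  \<comment> \<open>Cutting at \<open>N\<close> separates the old position from the shifted
    pair.\<close>
  have split: "i = i' \<and> P = P'" if "insert i ((+) N ` P) = insert i' ((+) N ` P')" "i < N" "i' < N"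
    for i i' and P P' :: "nat set"
  proof -
    have "insert i ((+) N ` P) \<inter> {..<N} = {i}" "insert i ((+) N ` P) \<inter> {N..} = (+) N ` P"
      "insert i' ((+) N ` P') \<inter> {..<N} = {i'}" "insert i' ((+) N ` P') \<inter> {N..} = (+) N ` P'"
      using that(2,3) by auto
    then have "{i} = {i'}" "(+) N ` P = (+) N ` P'"
      using that(1) by metis+
    then show ?thesis
      using inj by blast
  qed
  \<comment> \<open>Pairs and triples are nonempty, so the words built from them have a new position
    in their support.\<close>
  have old_or: "nonzeros d \<subseteq> {..<N} \<longleftrightarrow> (\<exists>s\<in>S. d = s @ replicate m 0)" if "d \<in> ext" for d
    using that
  proof cases
    case (old s)
    then show ?thesis
      using nonzeros_old[of s] by auto
  next
    case (mixed i v P)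
    then obtain p where "p \<in> P"
      using mixed_pair(2)[of i v P] by fastforce
    then have "\<not> nonzeros d \<subseteq> {..<N}"
      using nonzeros_mixed mixed by auto
    then show ?thesis
      using nonzeros_old by auto
  next
    case (new B)
    then obtain p where "p \<in> B"
      using triple(2)[of B] by fastforce
    then have "\<not> nonzeros d \<subseteq> {..<N}"
      using nonzeros_new new by auto
    then show ?thesis
      using nonzeros_old by auto
  qed
  show ?thesis
  proof (cases "nonzeros c \<subseteq> {..<N}")
    case True
    then obtain s s' where s: "s \<in> S" "c = s @ replicate m 0" "s' \<in> S" "c' = s' @ replicate m 0"
      using old_or c supp by metis
    then have "nonzeros s = nonzeros s'" "e \<in> nonzeros s" "s ! e = s' ! e"
      using supp e nonzeros_old(1,2)[of s] nonzeros_old(1)[of s'] nth_old[of _ e] by auto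
    then show ?thesis
      using mixed_steiner_triple_system_eq_supp[OF steiner] s by blast
  next
    case False
    then have not_old: "\<not> (\<exists>s\<in>S. c = s @ replicate m 0)" "\<not> (\<exists>s\<in>S. c' = s @ replicate m 0)"
      using old_or[OF c(1)] old_or[OF c(2)] False supp by simp_all
    from c(1) show ?thesis
    proof cases
      case (old s)
      then show ?thesis
        using not_old by blast
    next
      case (mixed i v P)
      note 1 = this
      from c(2) show ?thesis
      proof cases
        case (old s)
        then show ?thesis
          using not_old by blast
      next
        case (mixed i' v' P')
        then have "i = i' \<and> P = P'"
          using 1 supp nonzeros_mixed split by metis
        \<comment> \<open>The same pair lies in both one-factors, so their numbers agree, and
          \<open>idx_inj\<close> gives \<open>v = v'\<close>.\<close>
        then show ?thesis
          using 1 mixed factor_unique[of "idx i v" "idx i' v'" P] idx_range idx_inj by metis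
      next
        case (new B)
        \<comment> \<open>The support of a word from a triple lies at positions at least
          \<open>N\<close>, whereas \<open>i < N\<close>.\<close>
        then have "i \<in> (+) N ` B"
          using 1 supp nonzeros_mixed[of i v P] nonzeros_new[of B] by auto
        then show ?thesis
          using 1 by auto
      qed
    next
      case (new B)
      note 1 = this
      from c(2) show ?thesis
      proof cases
        case (old s)
        then show ?thesis
          using not_old by blast
      next
        case (mixed i' v' P')
        then have "i' \<in> (+) N ` B"
          using 1 supp nonzeros_mixed[of i' v' P'] nonzeros_new[of B] by auto
        then show ?thesis
          using mixed by auto
      next
        case (new B')
        then show ?thesis
          using 1 supp nonzeros_new inj by metis
      qed
    qed
  qed
qed

lemma ext_steiner: "mixed_steiner_triple_system (qs @ replicate m 2) ext"
proof (rule mixed_steiner_triple_systemI)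
  show "\<forall>q\<in>set (qs @ replicate m 2). 2 \<le> q"
    using mixed_steiner_triple_systemD(1)[OF steiner] by auto
  show "\<forall>c\<in>ext. weight c = 3"
    by (simp add: ext_weight)
  show "ext \<subseteq> words (qs @ replicate m 2)"
    by (rule ext_words)
  show "pair_property (qs @ replicate m 2) ext"
    by (rule ext_pair_property)
qed (rule ext_eq_supp)

end

theorem theorem3:
  fixes k l n m r :: nat
    and S :: "nat list set"
    and T :: "nat \<Rightarrow> nat set set"
    and R :: "nat set set"
  assumes "odd k" and "odd l" and "odd n"
    and "r = n + k + l"
    and "even m" and "m > n + k + l"
    and "mixed_steiner_triple_system (replicate n 2 @ [k + 1, l + 1]) S"
    and "pairs_triples_design m r T R"
  shows "mixed_steiner_triple_system (replicate n 2 @ [k + 1, l + 1] @ replicate m 2)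
           (extended_system n k l m S T R)"
proof -
  interpret steiner_extension k l n m r S T R "replicate n 2 @ [k + 1, l + 1]" "n + 2"
    by unfold_locales (use assms in auto)
  show ?thesis
    using ext_steiner extended_system_eq_ext by simp
qed

end
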